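(* Let $H$ be a Hilbert space, let $(\Omega,\mu)$ be a measure space with positive measure $\mu$, and let $(F,G)$, with $F,G:\Omega\to H$, be a continuous biframe for $H$ with respect to $(\Omega,\mu)$ with continuous biframe operator $S_{F,G}$ (assumed to be a bounded self-adjoint operator on $H$). Then $(S_{F,G}^{-1}F,\,G)$ and $(F,\,S_{F,G}^{-1}G)$ are dual continuous biframes for $H$.
   Context: Inner products are linear in the first variable. A pair $(F,G)$ of mappings $F,G:\Omega\to H$ is called a continuous biframe for $H$ with respect to $(\Omega,\mu)$ if (i) for every $f\in H$ the functions $w\mapsto\langle f,F(w)\rangle$ and $w\mapsto\langle f,G(w)\rangle$ are measurable on $\Omega$; and (ii) there exist constants $0<A\le B<\infty$ such that for all $f\in H$ $$A\|f\|^2\le\int_\Omega\langle f,F(w)\rangle\langle G(w),f\rangle\,d\mu\le B\|f\|^2.$$ The continuous biframe operator is $S_{F,G}:H\to H$, $S_{F,G}f=\int_\Omega\langle f,F(w)\rangle G(w)\,d\mu$, understood weakly: $\langle S_{F,G}f,g\rangle=\int_\Omega\langle f,F(w)\rangle\langle G(w),g\rangle\,d\mu$ for all $f,g\in H$. Standing assumption: these integrals exist and $S_{F,G}$ is a bounded self-adjoint operator; since $AI\le S_{F,G}\le BI$, it is then positive and invertible. $S_{F,G}^{-1}F$ denotes the mapping $w\mapsto S_{F,G}^{-1}(F(w))$, and similarly for $G$. A continuous biframe $(F,G)$ for $H$ is called a dual continuous biframe for $H$ if $\langle f,g\rangle=\int_\Omega\langle f,F(w)\rangle\langle G(w),g\rangle\,d\mu$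 for all $f,g\in H$. *)

theory Defs
  imports "HOL-Analysis.Analysis"
begin

text \<open>
  The scalars are \<open>\<real>\<close> or \<open>\<complex>\<close>. Up to isomorphism these are the only models of the following
  class: a real normed field of finite dimension is \<open>\<real>\<close> or \<open>\<complex>\<close>, and \<open>mult_conjugate\<close> then
  determines the involution. Both are instances below.
\<close>

class real_or_complex = real_normed_field + euclidean_space +
  fixes conjugate :: "'a \<Rightarrow> 'a"
  assumes conjugate_conjugate: "conjugate (conjugate a) = a"
    and conjugate_add: "conjugate (a + b) = conjugate a + conjugate b"
    and conjugate_mult: "conjugate (a * b) = conjugate a * conjugate b"
    and mult_conjugate: "a * conjugate a = (norm a)\<^sup>2 *\<^sub>R 1"

instantiation real :: real_or_complex
begin
definition conjugate_real :: "real \<Rightarrow> real" where "conjugate_real a = a"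
instance
  by standard (simp_all add: conjugate_real_def power2_eq_square)
end

instantiation complex :: real_or_complex
begin
definition conjugate_complex :: "complex \<Rightarrow> complex" where "conjugate_complex a = cnj a"
instance
  by standard (simp_all add: conjugate_complex_def complex_norm_square [symmetric] scaleR_conv_of_real)
end

text \<open>
  The Hilbert space is a whole type of class \<open>banach\<close>, whose norm is required to be the one induced
  by the inner product \<open>ip\<close>; positive definiteness is contained in \<open>ip_self\<close>, completeness in the
  class. The inner product is linear in its first argument.
\<close>

locale hilbert_space = vector_space smul
  for smul :: "'k::real_or_complex \<Rightarrow> 'h::banach \<Rightarrow> 'h" +
  fixes ip :: "'h \<Rightarrow> 'h \<Rightarrow> 'k"
  assumes smul_of_real: "smul (of_real r) x = r *\<^sub>R x"
    and ip_commute: "ip x y = conjugate (ip y x)"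
    and ip_add_left: "ip (x + y) z = ip x z + ip y z"
    and ip_smul_left: "ip (smul a x) y = a * ip x y"
    and ip_self: "ip x x = of_real ((norm x)\<^sup>2)"

definition bounded_operator :: "('k::real_or_complex \<Rightarrow> 'h::banach \<Rightarrow> 'h) \<Rightarrow> ('h \<Rightarrow> 'h) \<Rightarrow> bool"
  where "bounded_operator smul T \<longleftrightarrow>
    Vector_Spaces.linear smul smul T \<and> (\<exists>C. \<forall>f. norm (T f) \<le> C * norm f)"

definition self_adjoint :: "('h \<Rightarrow> 'h \<Rightarrow> 'k) \<Rightarrow> ('h \<Rightarrow> 'h) \<Rightarrow> bool"
  where "self_adjoint ip T \<longleftrightarrow> (\<forall>f g. ip (T f) g = ip f (T g))"

text \<open>
  The integral in the frame inequality is a scalar; the inequality is read as asserting that it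
  exists (\<open>has_bochner_integral\<close> includes integrability), is a real number \<open>r\<close>, and obeys the bounds.
\<close>

definition continuous_biframe ::
  "('h::banach \<Rightarrow> 'h \<Rightarrow> 'k::real_or_complex) \<Rightarrow> 'w measure \<Rightarrow> ('w \<Rightarrow> 'h) \<Rightarrow> ('w \<Rightarrow> 'h) \<Rightarrow> bool"
  where "continuous_biframe ip M F G \<longleftrightarrow>
    (\<forall>f. (\<lambda>w. ip f (F w)) \<in> borel_measurable M \<and> (\<lambda>w. ip f (G w)) \<in> borel_measurable M) \<and>
    (\<exists>A B :: real. 0 < A \<and> A \<le> B \<and>
      (\<forall>f. \<exists>r :: real. has_bochner_integral M (\<lambda>w. ip f (F w) * ip (G w) f) (of_real r) \<and>
        A * (norm f)\<^sup>2 \<le> r \<and> r \<le> B * (norm f)\<^sup>2))"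

text \<open>
  \<open>S f = (\<integral>w. ip f (F w) G w \<partial>M)\<close> in the weak sense. For an inner product \<open>ip\<close> at most one \<open>S\<close>
  satisfies this.
\<close>

definition is_biframe_operator ::
  "('h::banach \<Rightarrow> 'h \<Rightarrow> 'k::real_or_complex) \<Rightarrow> 'w measure \<Rightarrow> ('w \<Rightarrow> 'h) \<Rightarrow> ('w \<Rightarrow> 'h) \<Rightarrow> ('h \<Rightarrow> 'h) \<Rightarrow> bool"
  where "is_biframe_operator ip M F G S \<longleftrightarrow>
    (\<forall>f g. has_bochner_integral M (\<lambda>w. ip f (F w) * ip (G w) g) (ip (S f) g))"

definition dual_continuous_biframe ::
  "('h::banach \<Rightarrow> 'h \<Rightarrow> 'k::real_or_complex) \<Rightarrow> 'w measure \<Rightarrow> ('w \<Rightarrow> 'h) \<Rightarrow> ('w \<Rightarrow> 'h) \<Rightarrow> bool"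
  where "dual_continuous_biframe ip M F G \<longleftrightarrow>
    continuous_biframe ip M F G \<and>
    (\<forall>f g. has_bochner_integral M (\<lambda>w. ip f (F w) * ip (G w) g) (ip f g))"

end

theory Submission
  imports Defs
begin

text \<open>
  The frame inequality makes the biframe operator \<open>S\<close> bounded below in the strong sense that
  \<open>A \<parallel>f\<parallel>\<^sup>2 \<le> \<langle>S f, f\<rangle>\<close>. A bounded self-adjoint operator with this coercivity is bijective
  (\<open>coercive_bij\<close>): the map \<open>f \<mapsto> f - t (S f - g)\<close> is a contraction for a small step \<open>t\<close>, and its
  unique fixed point is the unique solution of \<open>S f = g\<close>.

  So \<open>inv S\<close> is a genuine two-sided inverse, and it inherits self-adjointness from \<open>S\<close>. Moving it
  across the inner product turns the integrals of the two new pairs into the defining integral of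
  \<open>S\<close>, evaluated at \<open>(S\<inverse> f, g)\<close> and at \<open>(f, S\<inverse> g)\<close>; these are \<open>\<langle>S S\<inverse> f, g\<rangle>\<close> and
  \<open>\<langle>S f, S\<inverse> g\<rangle>\<close>, both equal to \<open>\<langle>f, g\<rangle>\<close>. Reproducing the inner product in this way already contains
  the frame inequality, with both bounds equal to \<open>1\<close> (\<open>dual_continuous_biframeI\<close>).
\<close>

text \<open>
  For real \<open>r \<noteq> 0\<close>, the axiom \<open>mult_conjugate\<close> reads \<open>r * conjugate r = r\<^sup>2\<close>, and \<open>r\<close> can be cancelled.
\<close>
lemma conjugate_of_real: "conjugate (of_real r :: 'k::real_or_complex) = of_real r"
proof (cases "r = 0")
  case True
  have "conjugate (0::'k) + conjugate 0 = conjugate 0"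
    by (metis conjugate_add add_0)
  then show ?thesis using True by simp
next
  case False
  have "(of_real r :: 'k) * conjugate (of_real r) = of_real r * of_real r"
    by (simp add: mult_conjugate scaleR_conv_of_real power2_eq_square)
  then show ?thesis using False by simp
qed

context hilbert_space
begin

lemma ip_scaleR_left: "ip (r *\<^sub>R x) y = of_real r * ip x y"
  by (metis smul_of_real ip_smul_left)

lemma ip_scaleR_right: "ip x (r *\<^sub>R y) = of_real r * ip x y"
  by (metis ip_commute ip_scaleR_left conjugate_mult conjugate_of_real)

lemma ip_add_right: "ip x (y + z) = ip x y + ip x z"
  by (metis ip_commute ip_add_left conjugate_add)

lemma ip_diff_left: "ip (x - y) z = ip x z - ip y z"
  using ip_add_left[of "x - y" y z] by (simp add: algebra_simps)

lemma ip_diff_right: "ip x (y - z) = ip x y - ip x z"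
  using ip_add_right[of x "y - z" z] by (simp add: algebra_simps)

lemma norm_diff_scaleR_sq:
  assumes "ip x y = of_real r" "ip y x = of_real r"
  shows "(norm (x - t *\<^sub>R y))\<^sup>2 = (norm x)\<^sup>2 - 2 * t * r + t\<^sup>2 * (norm y)\<^sup>2"
proof -
  have "(of_real ((norm (x - t *\<^sub>R y))\<^sup>2) :: 'k) = ip (x - t *\<^sub>R y) (x - t *\<^sub>R y)"
    by (rule ip_self [symmetric])
  also have "\<dots> = of_real ((norm x)\<^sup>2 - 2 * t * r + t\<^sup>2 * (norm y)\<^sup>2)"
    unfolding ip_diff_left ip_diff_right ip_scaleR_left ip_scaleR_right assms
    by (simp add: ip_self algebra_simps power2_eq_square)
  finally show ?thesis by (simp only: of_real_eq_iff)
qed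

text \<open>
  A form of the Lax--Milgram lemma. Coercivity supplies the negative term in the estimate
  \<open>\<parallel>d - t S d\<parallel>\<^sup>2 \<le> (1 - 2 t A + t\<^sup>2 C\<^sup>2) \<parallel>d\<parallel>\<^sup>2\<close>, so that \<open>f \<mapsto> f - t (S f - g)\<close> contracts.
\<close>
lemma coercive_bij:
  assumes S: "bounded_operator smul S" "self_adjoint ip S"
    and A: "0 < A"
    and coercive: "\<And>f. \<exists>r. ip (S f) f = of_real r \<and> A * (norm f)\<^sup>2 \<le> r"
  shows "bij S"
proof -
  have "module_hom smul smul S"
    using S(1) by (simp add: bounded_operator_def Vector_Spaces.linear_def)
  then have S_diff: "S (x - y) = S x - S y" for x y
    by (rule module_hom.diff)
  obtain C0 where C0: "\<And>f. norm (S f) \<le> C0 * norm f"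
    using S(1) unfolding bounded_operator_def by blast
  \<comment> \<open>Enlarging the bound to at least \<open>A\<close> keeps \<open>1 - A\<^sup>2 / C\<^sup>2\<close> in \<open>[0, 1)\<close>.\<close>
  define C where "C = max C0 A"
  have C: "0 < C" "A \<le> C" using A by (auto simp: C_def)
  have S_le: "norm (S f) \<le> C * norm f" for f
    using C0[of f] mult_right_mono[of C0 C "norm f"] by (simp add: C_def)
  \<comment> \<open>This step minimises \<open>1 - 2 t A + t\<^sup>2 C\<^sup>2\<close>; the minimum is \<open>1 - A\<^sup>2 / C\<^sup>2\<close>.\<close>
  define t where "t = A / C\<^sup>2"
  define c where "c = sqrt (1 - A\<^sup>2 / C\<^sup>2)"
  have t: "0 < t" using A C by (simp add: t_def)
  have q: "0 \<le> 1 - A\<^sup>2 / C\<^sup>2" "1 - A\<^sup>2 / C\<^sup>2 < 1"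
    using A C by (simp_all add: power_mono)
  have c: "0 \<le> c" "c < 1" using q by (simp_all add: c_def)
  have contract: "norm (d - t *\<^sub>R S d) \<le> c * norm d" for d
  proof -
    obtain r where r: "ip (S d) d = of_real r" "A * (norm d)\<^sup>2 \<le> r"
      using coercive by blast
    have r': "ip d (S d) = of_real r"
      using S(2) r(1) by (simp add: self_adjoint_def)
    have "(norm (d - t *\<^sub>R S d))\<^sup>2 = (norm d)\<^sup>2 - 2 * t * r + t\<^sup>2 * (norm (S d))\<^sup>2"
      by (rule norm_diff_scaleR_sq [OF r' r(1)])
    also have "\<dots> \<le> (norm d)\<^sup>2 - 2 * t * (A * (norm d)\<^sup>2) + t\<^sup>2 * (C * norm d)\<^sup>2"
      using r(2) t S_le[of d] by (intro add_mono diff_mono mult_left_mono power_mono) auto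
    also have "\<dots> = (1 - A\<^sup>2 / C\<^sup>2) * (norm d)\<^sup>2"
      using C(1) by (simp add: t_def field_simps power2_eq_square)
    also have "\<dots> = (c * norm d)\<^sup>2"
      using q(1) by (simp add: c_def power_mult_distrib)
    finally show ?thesis
      by (rule power2_le_imp_le) (simp add: c(1))
  qed
  have "\<exists>!f. S f = g" for g
  proof -
    have "\<exists>!f. f - t *\<^sub>R (S f - g) = f"
    proof (rule banach_fix_type [OF c], intro allI)
      fix x y
      have "(x - t *\<^sub>R (S x - g)) - (y - t *\<^sub>R (S y - g)) = (x - y) - t *\<^sub>R S (x - y)"
        by (simp add: S_diff algebra_simps)
      then show "dist (x - t *\<^sub>R (S x - g)) (y - t *\<^sub>R (S y - g)) \<le> c * dist x y"
        using contract[of "x - y"] by (simp only: dist_norm)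
    qed
    then show ?thesis using t by simp
  qed
  then show ?thesis by (metis bij_iff)
qed

lemma self_adjoint_inv:
  assumes "self_adjoint ip S" "bij S"
  shows "self_adjoint ip (inv S)"
  unfolding self_adjoint_def
proof (intro allI)
  fix f g
  have S_inv: "S (inv S h) = h" for h
    using assms(2) by (simp add: bij_is_surj surj_f_inv_f)
  have "ip (inv S f) (S (inv S g)) = ip (S (inv S f)) (inv S g)"
    using assms(1) unfolding self_adjoint_def by metis
  then show "ip (inv S f) g = ip f (inv S g)"
    by (simp only: S_inv)
qed

lemma dual_continuous_biframeI:
  assumes "\<And>f. (\<lambda>w. ip f (F w)) \<in> borel_measurable M"
    and "\<And>f. (\<lambda>w. ip f (G w)) \<in> borel_measurable M"
    and "\<And>f g. has_bochner_integral M (\<lambda>w. ip f (F w) * ip (G w) g) (ip f g)"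
  shows "dual_continuous_biframe ip M F G"
proof -
  have "has_bochner_integral M (\<lambda>w. ip f (F w) * ip (G w) f) (of_real ((norm f)\<^sup>2))" for f
    using assms(3)[of f f] by (simp only: ip_self)
  then have "\<forall>f. \<exists>r. has_bochner_integral M (\<lambda>w. ip f (F w) * ip (G w) f) (of_real r) \<and>
      1 * (norm f)\<^sup>2 \<le> r \<and> r \<le> 1 * (norm f)\<^sup>2"
    by (metis mult_1 order_refl)
  then have "continuous_biframe ip M F G"
    unfolding continuous_biframe_def using assms(1,2) zero_less_one order_refl by blast
  then show ?thesis
    unfolding dual_continuous_biframe_def using assms(3) by blast
qed

text \<open>
  Both the frame inequality and the weak definition of \<open>S\<close> evaluate the same integral, which
  identifies the number in the inequality with \<open>\<langle>S f, f\<rangle>\<close>.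
\<close>
lemma biframe_operator_coercive:
  assumes "continuous_biframe ip M F G" "is_biframe_operator ip M F G S"
  obtains A where "0 < A" "\<And>f. \<exists>r. ip (S f) f = of_real r \<and> A * (norm f)\<^sup>2 \<le> r"
proof -
  obtain A where "0 < A" and
    A: "\<And>f. \<exists>r. has_bochner_integral M (\<lambda>w. ip f (F w) * ip (G w) f) (of_real r) \<and>
      A * (norm f)\<^sup>2 \<le> r"
    using assms(1) unfolding continuous_biframe_def by blast
  moreover have "\<exists>r. ip (S f) f = of_real r \<and> A * (norm f)\<^sup>2 \<le> r" for f
    using A[of f] assms(2) unfolding is_biframe_operator_def
    by (metis has_bochner_integral_eq)
  ultimately show ?thesis using that by blast
qed

end

theorem theorem3p18:
  fixes smul :: "'k::real_or_complex \<Rightarrow> 'h::banach \<Rightarrow> 'h"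
    and ip :: "'h \<Rightarrow> 'h \<Rightarrow> 'k"
    and M :: "'w measure"
    and F G :: "'w \<Rightarrow> 'h"
    and S :: "'h \<Rightarrow> 'h"
  assumes "hilbert_space smul ip"
    and "continuous_biframe ip M F G"
    and "is_biframe_operator ip M F G S"
    and "bounded_operator smul S"
    and "self_adjoint ip S"
  shows "dual_continuous_biframe ip M (\<lambda>w. inv S (F w)) G \<and>
    dual_continuous_biframe ip M F (\<lambda>w. inv S (G w))"
proof -
  interpret hilbert_space smul ip by fact
  obtain A where "0 < A" "\<And>f. \<exists>r. ip (S f) f = of_real r \<and> A * (norm f)\<^sup>2 \<le> r"
    using biframe_operator_coercive assms(2,3) by blast
  then have bij: "bij S"
    using coercive_bij assms(4,5) by blast
  then have S_inv: "S (inv S f) = f" for f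
    by (simp add: bij_is_surj surj_f_inv_f)
  have inv_adj: "ip (inv S f) g = ip f (inv S g)" for f g
    using self_adjoint_inv [OF assms(5) bij] by (simp add: self_adjoint_def)
  have S_adj: "ip (S f) g = ip f (S g)" for f g
    using assms(5) by (simp add: self_adjoint_def)
  have meas: "(\<lambda>w. ip f (F w)) \<in> borel_measurable M" "(\<lambda>w. ip f (G w)) \<in> borel_measurable M" for f
    using assms(2) by (simp_all add: continuous_biframe_def)
  have int: "has_bochner_integral M (\<lambda>w. ip f (F w) * ip (G w) g) (ip (S f) g)" for f g
    using assms(3) by (simp add: is_biframe_operator_def)
  have "dual_continuous_biframe ip M (\<lambda>w. inv S (F w)) G"
  proof (rule dual_continuous_biframeI)
    show "has_bochner_integral M (\<lambda>w. ip f (inv S (F w)) * ip (G w) g) (ip f g)" for f g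
      using int[of "inv S f" g] by (simp add: S_inv inv_adj)
  qed (simp_all add: meas flip: inv_adj)
  moreover have "dual_continuous_biframe ip M F (\<lambda>w. inv S (G w))"
  proof (rule dual_continuous_biframeI)
    show "has_bochner_integral M (\<lambda>w. ip f (F w) * ip (inv S (G w)) g) (ip f g)" for f g
      using int[of f "inv S g"] by (simp add: S_adj S_inv inv_adj)
  qed (simp_all add: meas flip: inv_adj)
  ultimately show ?thesis by blast
qed

end
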